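(* Let $G$ be a simple and connected graph with boundary, with interior vertices $\Omega_G=\{v_1,v_2,\ldots,v_k\}$, $k\ge 2$, numbered in such a way that $\deg(v_1)=\min_{1\le i\le k}\deg(v_i)$ and $\deg(v_2)=\min_{2\le i\le k}\deg(v_i)$. Put $d_1=\deg(v_1)$ and $d_2=\deg(v_2)$. Then the second Neumann eigenvalue of $G$ satisfies $$\lambda_2(G)\ \le\ \begin{cases}\dfrac{d_1+d_2}{2}+1, & \text{if } v_1\sim v_2,\\[2mm] \dfrac{d_1+d_2}{2}, & \text{if } v_1\nsim v_2.\end{cases}$$
   Context: All graphs are finite, simple and undirected, $G=(V,E)$; $x\sim y$ means $x,y$ are adjacent, and $\deg(v)$ is the number of neighbours of $v$ in $G$ (interior and boundary). For $S\subset V$, $\delta S=\{i\in V\setminus S: i\sim j\text{ for some }j\in S\}$. A graph with boundary is a pair $(G,B)$ with $B\subset V$, $\delta(V\setminus B)=B$, and no edge of $G$ joining two vertices of $B$. The set $B$ is the boundary, $\Omega_G=V\setminus B$ is the interior (so $B=\delta\Omega_G$), and $k=|\Omega_G|$. For $f\in\mathbb{R}^V$ put $(\Delta f)(x)=\sum_{y\sim x}(f(x)-f(y))$ for $x\in V$, and $\frac{\partial f}{\partial\nu}(x)=\sum_{y\in\Omega_G,\,y\sim x}(f(x)-f(y))$ for $x\in\delta\Omega_G$. The Neumann eigenvalue problem asks for nonzero $f\in\mathbb{R}^V$ and $\lambda\in\mathbb{R}$ with $\Delta f=\lambda f$ on $\Omega_G$ and $\frac{\partial f}{\partial \nu}=0$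 on $\delta\Omega_G$. Equivalently, the Neumann eigenvalues are the eigenvalues of $\Delta^N:\mathbb{R}^{\Omega_G}\to\mathbb{R}^{\Omega_G}$, $\Delta^N f=\Delta(\Lambda f)|_{\Omega_G}$, where $\Lambda f=f$ on $\Omega_G$ and $(\Lambda f)(x)=\frac{1}{\deg(x)}\sum_{y\sim x}f(y)$ for $x\in\delta\Omega_G$. The operator $\Delta^N$ is self-adjoint and non-negative, and for connected $G$ its eigenvalues, counted with multiplicity, are listed as $0=\lambda_1(G)<\lambda_2(G)\le\cdots\le\lambda_k(G)$. *)

theory Defs
  imports
    "HOL-Analysis.Analysis"
    "HOL-Library.Multiset"
    "Graph_Theory.Digraph_Component"
begin

text \<open>
  A finite simple undirected graph is a \<open>pair_graph\<close>: a finite, loop-free digraph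
  whose arc set is a symmetric set of ordered pairs.  Vertices live in a finite type
  \<open>'v\<close>, but \<open>pverts G\<close> may be any subset of it.
\<close>

definition neighbours :: "'v pair_pre_digraph \<Rightarrow> 'v \<Rightarrow> 'v set" where
  "neighbours G x = {y \<in> pverts G. x \<rightarrow>\<^bsub>with_proj G\<^esub> y}"

definition deg :: "'v pair_pre_digraph \<Rightarrow> 'v \<Rightarrow> nat" where
  "deg G x = card (neighbours G x)"

definition vertex_boundary :: "'v pair_pre_digraph \<Rightarrow> 'v set \<Rightarrow> 'v set" where
  "vertex_boundary G S = {i \<in> pverts G - S. \<exists>j\<in>S. i \<rightarrow>\<^bsub>with_proj G\<^esub> j}"

definition interior_verts :: "'v pair_pre_digraph \<Rightarrow> 'v set \<Rightarrow> 'v set" where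
  "interior_verts G B = pverts G - B"

definition graph_with_boundary :: "'v pair_pre_digraph \<Rightarrow> 'v set \<Rightarrow> bool" where
  "graph_with_boundary G B \<longleftrightarrow>
     pair_graph G \<and> B \<subseteq> pverts G \<and>
     vertex_boundary G (interior_verts G B) = B \<and>
     (\<forall>x\<in>B. \<forall>y\<in>B. \<not> x \<rightarrow>\<^bsub>with_proj G\<^esub> y)"

text \<open>
  For \<open>S \<subseteq> UNIV\<close>, the space of real functions on \<open>S\<close> is identified with the
  subspace of vectors in \<open>real ^ 'v\<close> that vanish outside \<open>S\<close>.
\<close>

definition functions_on :: "'v set \<Rightarrow> (real ^ 'v::finite) set" where
  "functions_on S = {f. \<forall>x. x \<notin> S \<longrightarrow> f $ x = 0}"

definition laplacian :: "'v pair_pre_digraph \<Rightarrow> real ^ 'v \<Rightarrow> real ^ 'v::finite" where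
  "laplacian G f = (\<chi> x. \<Sum>y\<in>neighbours G x. f $ x - f $ y)"

definition normal_derivative ::
    "'v pair_pre_digraph \<Rightarrow> 'v set \<Rightarrow> real ^ 'v::finite \<Rightarrow> 'v \<Rightarrow> real" where
  "normal_derivative G B f x = (\<Sum>y\<in>neighbours G x \<inter> interior_verts G B. f $ x - f $ y)"

definition neumann_extension ::
    "'v pair_pre_digraph \<Rightarrow> 'v set \<Rightarrow> real ^ 'v \<Rightarrow> real ^ 'v::finite" where
  "neumann_extension G B f =
     (\<chi> x. if x \<in> interior_verts G B then f $ x
           else if x \<in> B then (1 / real (deg G x)) * (\<Sum>y\<in>neighbours G x. f $ y)
           else 0)"

definition neumann_laplacian ::
    "'v pair_pre_digraph \<Rightarrow> 'v set \<Rightarrow> real ^ 'v \<Rightarrow> real ^ 'v::finite" where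
  "neumann_laplacian G B f =
     (\<chi> x. if x \<in> interior_verts G B then laplacian G (neumann_extension G B f) $ x else 0)"

definition neumann_eigenspace ::
    "'v pair_pre_digraph \<Rightarrow> 'v set \<Rightarrow> real \<Rightarrow> (real ^ 'v::finite) set" where
  "neumann_eigenspace G B \<mu> =
     {f \<in> functions_on (interior_verts G B). neumann_laplacian G B f = \<mu> *\<^sub>R f}"

definition neumann_spectrum :: "'v::finite pair_pre_digraph \<Rightarrow> 'v set \<Rightarrow> real set" where
  "neumann_spectrum G B = {\<mu>. \<exists>f\<in>neumann_eigenspace G B \<mu>. f \<noteq> 0}"

text \<open>
  The multiplicity of an eigenvalue is the dimension of its eigenspace; since the operator
  is self-adjoint this is also its algebraic multiplicity.
\<close>

definition neumann_eigenvalues :: "'v::finite pair_pre_digraph \<Rightarrow> 'v set \<Rightarrow> real list" where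
  "neumann_eigenvalues G B =
     sorted_list_of_multiset
       (\<Sum>\<mu>\<in>neumann_spectrum G B. replicate_mset (dim (neumann_eigenspace G B \<mu>)) \<mu>)"

text \<open>The \<open>j\<close>-th smallest eigenvalue, \<open>j = 1, \<dots>, k\<close>; list indices start at \<open>0\<close>.\<close>

definition neumann_eigenvalue :: "'v::finite pair_pre_digraph \<Rightarrow> 'v set \<Rightarrow> nat \<Rightarrow> real" where
  "neumann_eigenvalue G B j = neumann_eigenvalues G B ! (j - 1)"

text \<open>
  The spectrum of the Neumann Laplacian consists of the eigenvalues of the Neumann problem.
\<close>

lemma neumann_spectrum_iff_neumann_problem:
  fixes G :: "'v::finite pair_pre_digraph"
  assumes "graph_with_boundary G B"
  shows "\<mu> \<in> neumann_spectrum G B \<longleftrightarrow>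
    (\<exists>f\<in>functions_on (pverts G). f \<noteq> 0 \<and>
       (\<forall>x\<in>interior_verts G B. laplacian G f $ x = \<mu> * f $ x) \<and>
       (\<forall>x\<in>B. normal_derivative G B f x = 0))"
proof -
  have Bsub: "B \<subseteq> pverts G" and bd: "vertex_boundary G (interior_verts G B) = B"
    and BB: "\<And>x y. x \<in> B \<Longrightarrow> y \<in> B \<Longrightarrow> \<not> x \<rightarrow>\<^bsub>with_proj G\<^esub> y"
    using assms by (auto simp: graph_with_boundary_def)
  have nb: "neighbours G x \<subseteq> interior_verts G B" if "x \<in> B" for x
    using BB[OF that] by (auto simp: neighbours_def interior_verts_def)
  have degpos: "deg G x > 0" if "x \<in> B" for x
    using that bd[symmetric] unfolding vertex_boundary_def deg_def neighbours_def interior_verts_def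
    by (auto simp: card_gt_0_iff)
  have nd: "normal_derivative G B f x = real (deg G x) * f $ x - (\<Sum>y\<in>neighbours G x. f $ y)"
    if "x \<in> B" for f x
    using nb[OF that] by (simp add: normal_derivative_def Int_absorb2 sum_subtractf deg_def)
  show ?thesis
  proof
    assume "\<mu> \<in> neumann_spectrum G B"
    then obtain f where f: "f \<in> functions_on (interior_verts G B)" "f \<noteq> 0"
      and eq: "neumann_laplacian G B f = \<mu> *\<^sub>R f"
      by (auto simp: neumann_spectrum_def neumann_eigenspace_def)
    define g where "g = neumann_extension G B f"
    have gI: "g $ x = f $ x" if "x \<in> interior_verts G B" for x
      using that by (simp add: g_def neumann_extension_def)
    have "g \<in> functions_on (pverts G)"
      using Bsub by (auto simp: g_def functions_on_def neumann_extension_def interior_verts_def)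
    moreover have "g \<noteq> 0"
    proof
      assume "g = 0"
      then have "f $ x = 0" for x
        using gI[of x] f(1) by (cases "x \<in> interior_verts G B") (auto simp: functions_on_def)
      then show False using f(2) by (simp add: vec_eq_iff)
    qed
    moreover have "laplacian G g $ x = \<mu> * g $ x" if "x \<in> interior_verts G B" for x
      using arg_cong[OF eq, of "\<lambda>h. h $ x"] that gI[OF that]
      by (simp add: neumann_laplacian_def g_def)
    moreover have "normal_derivative G B g x = 0" if "x \<in> B" for x
    proof -
      have "(\<Sum>y\<in>neighbours G x. g $ y) = (\<Sum>y\<in>neighbours G x. f $ y)"
        using nb[OF that] gI by (intro sum.cong) auto
      moreover have "g $ x = (1 / real (deg G x)) * (\<Sum>y\<in>neighbours G x. f $ y)"
        using that by (simp add: g_def neumann_extension_def interior_verts_def)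
      ultimately show ?thesis using degpos[OF that] by (simp add: nd[OF that])
    qed
    ultimately show "\<exists>f\<in>functions_on (pverts G). f \<noteq> 0 \<and>
       (\<forall>x\<in>interior_verts G B. laplacian G f $ x = \<mu> * f $ x) \<and>
       (\<forall>x\<in>B. normal_derivative G B f x = 0)" by blast
  next
    assume "\<exists>f\<in>functions_on (pverts G). f \<noteq> 0 \<and>
       (\<forall>x\<in>interior_verts G B. laplacian G f $ x = \<mu> * f $ x) \<and>
       (\<forall>x\<in>B. normal_derivative G B f x = 0)"
    then obtain f where f: "f \<in> functions_on (pverts G)" "f \<noteq> 0"
      and lap: "\<And>x. x \<in> interior_verts G B \<Longrightarrow> laplacian G f $ x = \<mu> * f $ x"
      and n0: "\<And>x. x \<in> B \<Longrightarrow> normal_derivative G B f x = 0" by blast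
    define g :: "real ^ 'v" where "g = (\<chi> x. if x \<in> interior_verts G B then f $ x else 0)"
    have ext: "neumann_extension G B g = f"
      unfolding vec_eq_iff
    proof
      fix x
      consider "x \<in> interior_verts G B" | "x \<in> B" | "x \<notin> pverts G"
        by (auto simp: interior_verts_def)
      then show "neumann_extension G B g $ x = f $ x"
      proof cases
        case 1
        then show ?thesis by (simp add: neumann_extension_def g_def)
      next
        case 2
        have "(\<Sum>y\<in>neighbours G x. g $ y) = (\<Sum>y\<in>neighbours G x. f $ y)"
          using nb[OF 2] by (intro sum.cong) (auto simp: g_def)
        then show ?thesis
          using 2 n0[OF 2] degpos[OF 2]
          by (simp add: neumann_extension_def interior_verts_def nd[OF 2] field_simps)
      next
        case 3
        then show ?thesis
          using f(1) Bsub by (auto simp: neumann_extension_def interior_verts_def functions_on_def)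
      qed
    qed
    have "g \<noteq> 0"
    proof
      assume "g = 0"
      then have "neumann_extension G B g = 0" by (simp add: neumann_extension_def vec_eq_iff)
      then show False using ext f(2) by simp
    qed
    moreover have "g \<in> functions_on (interior_verts G B)"
      by (simp add: g_def functions_on_def)
    moreover have "neumann_laplacian G B g = \<mu> *\<^sub>R g"
      using lap by (simp add: vec_eq_iff neumann_laplacian_def ext) (simp add: g_def)
    ultimately show "\<mu> \<in> neumann_spectrum G B"
      by (auto simp: neumann_spectrum_def neumann_eigenspace_def)
  qed
qed

end

theory Submission
  imports Defs
begin

text \<open>
  The Neumann Laplacian \<open>N\<close> is self-adjoint (\<open>inner_neumann_laplacian_commute\<close>) and
  annihilates the indicator \<open>u\<close> of the interior \<open>\<Omega>\<close> (\<open>neumann_laplacian_indicator\<close>).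
  Hence it preserves the space \<open>S\<close> of functions on \<open>\<Omega>\<close> orthogonal to \<open>u\<close>, and the minimum
  \<open>\<mu>\<close> of its Rayleigh quotient on \<open>S\<close> is an eigenvalue with an eigenvector in \<open>S\<close>
  (\<open>self_adjoint_min_eigenvector\<close>).  Together with the eigenvalue \<open>0\<close> of \<open>u\<close>, this gives two
  eigenvalues, counted with multiplicity, that are at most \<open>max 0 \<mu>\<close>; so \<open>\<lambda>\<^sub>2\<close> is bounded by any
  nonnegative upper bound for the Rayleigh quotient of a single nonzero test function in \<open>S\<close>
  (\<open>neumann_eigenvalue_2_le_Rayleigh\<close>).

  The test function is \<open>g = 1\<^sub>a - 1\<^sub>b\<close> with \<open>a = v\<^sub>1\<close> and \<open>b = v\<^sub>2\<close>, for which \<open>g \<bullet> g = 2\<close>.  Let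
  \<open>F\<close> be its Neumann extension.  Then
  \<open>g \<bullet> N g = deg a + deg b - (\<Sum>z\<sim>a. F z) + (\<Sum>z\<sim>b. F z)\<close>.  At a boundary vertex \<open>z\<close> the value
  \<open>F z\<close> is an average of \<open>g\<close> over the neighbours of \<open>z\<close>, so it is nonnegative when \<open>z \<sim> a\<close> and
  nonpositive when \<open>z \<sim> b\<close>.  At an interior vertex \<open>F\<close> vanishes except for \<open>F a = 1\<close> and
  \<open>F b = -1\<close>, and these two values enter the sums exactly when \<open>a \<sim> b\<close>.  Therefore
  \<open>g \<bullet> N g\<close> is at most \<open>deg a + deg b + 2\<close> if \<open>a \<sim> b\<close>, and at most \<open>deg a + deg b\<close> otherwise.
\<close>

section \<open>Self-adjoint operators on an invariant subspace\<close>

text \<open>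
  The minimum \<open>\<mu>\<close> of the quadratic form on the unit sphere of \<open>S\<close> is attained by compactness.
  The form \<open>q f = f \<bullet> (T f - \<mu> f)\<close> is then nonnegative on \<open>S\<close> and vanishes at the minimiser
  \<open>h\<close>, so \<open>h\<close> lies in its radical; as \<open>T h - \<mu> h\<close> is itself in \<open>S\<close>, it is \<open>0\<close>.
\<close>

lemma self_adjoint_min_eigenvector:
  fixes T :: "'a::euclidean_space \<Rightarrow> 'a"
  assumes lin: "linear T" and adj: "\<And>f g. T f \<bullet> g = f \<bullet> T g"
    and S: "subspace S" "\<And>f. f \<in> S \<Longrightarrow> T f \<in> S" and ne: "f0 \<in> S" "f0 \<noteq> 0"
  obtains h \<mu> where "h \<in> S" "h \<noteq> 0" "T h = \<mu> *\<^sub>R h" "\<And>f. f \<in> S \<Longrightarrow> \<mu> * (f \<bullet> f) \<le> f \<bullet> T f"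
proof -
  let ?K = "S \<inter> sphere 0 1"
  have "compact ?K"
    using S(1) by (simp add: closed_Int_compact closed_subspace)
  moreover have "f0 /\<^sub>R norm f0 \<in> ?K"
    using ne S(1) by (simp add: subspace_scale)
  moreover have "continuous_on ?K (\<lambda>f. f \<bullet> T f)"
    using lin by (intro continuous_intros linear_continuous_on) (simp add: linear_conv_bounded_linear)
  ultimately obtain h where h: "h \<in> ?K" and hmin: "\<And>f. f \<in> ?K \<Longrightarrow> h \<bullet> T h \<le> f \<bullet> T f"
    using continuous_attains_inf[of ?K "\<lambda>f. f \<bullet> T f"] by blast
  define \<mu> where "\<mu> = h \<bullet> T h"
  have hS: "h \<in> S" and hn: "h \<bullet> h = 1" and h0: "h \<noteq> 0"
    using h by (auto simp: norm_eq_1)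
  have min: "\<mu> * (f \<bullet> f) \<le> f \<bullet> T f" if "f \<in> S" for f
  proof (cases "f = 0")
    case False
    then have "\<mu> \<le> (f /\<^sub>R norm f) \<bullet> T (f /\<^sub>R norm f)"
      unfolding \<mu>_def using that S(1) by (intro hmin) (simp add: subspace_scale)
    also have "\<dots> = (f \<bullet> T f) / (f \<bullet> f)"
      using lin by (simp add: linear_scale power2_norm_eq_inner[symmetric] power2_eq_square divide_simps)
    finally show ?thesis using False by (simp add: field_simps)
  qed simp
  define w where "w = T h - \<mu> *\<^sub>R h"
  have wS: "w \<in> S"
    using S hS by (simp add: w_def subspace_diff subspace_scale)
  define c where "c = w \<bullet> T w - \<mu> * (w \<bullet> w)"
  have c: "c \<ge> 0" using min[OF wS] by (simp add: c_def)
  have quad: "0 \<le> 2 * t * (w \<bullet> w) + t\<^sup>2 * c" for t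
  proof -
    have "0 \<le> (h + t *\<^sub>R w) \<bullet> T (h + t *\<^sub>R w) - \<mu> * ((h + t *\<^sub>R w) \<bullet> (h + t *\<^sub>R w))"
      using min[of "h + t *\<^sub>R w"] hS wS S(1) by (simp add: subspace_add subspace_scale)
    also have "\<dots> = (h \<bullet> T h - \<mu> * (h \<bullet> h)) + 2 * t * (w \<bullet> T h - \<mu> * (w \<bullet> h)) + t\<^sup>2 * c"
      using lin adj[of h w]
      by (simp add: linear_add linear_scale c_def algebra_simps power2_eq_square inner_commute)
    also have "h \<bullet> T h - \<mu> * (h \<bullet> h) = 0" by (simp add: \<mu>_def hn)
    also have "w \<bullet> T h - \<mu> * (w \<bullet> h) = w \<bullet> w"
      by (simp add: w_def inner_diff_left inner_diff_right)
    finally show ?thesis by simp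
  qed
  \<comment> \<open>At \<open>t = - s\<close> the linear term of \<open>quad\<close> outweighs the quadratic one, as \<open>c < 2 * (c + 1)\<close>.\<close>
  define s where "s = (w \<bullet> w) / (c + 1)"
  have s: "w \<bullet> w = s * (c + 1)" using c by (simp add: s_def)
  have "0 \<le> 2 * (- s) * (w \<bullet> w) + (- s)\<^sup>2 * c"
    by (rule quad)
  also have "\<dots> = - (s\<^sup>2 * (c + 2))"
    unfolding s by (simp add: algebra_simps power2_eq_square)
  finally have "s\<^sup>2 * (c + 2) \<le> 0" by simp
  then have "s = 0" using c by (simp add: mult_le_0_iff)
  then have "w = 0" using s by simp
  then have "T h = \<mu> *\<^sub>R h" by (simp add: w_def)
  with that hS h0 min show ?thesis by blast
qed

lemma self_adjoint_eigenvectors_orthogonal: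
  fixes T :: "'a::real_inner \<Rightarrow> 'a"
  assumes "T f \<bullet> g = f \<bullet> T g" "T f = a *\<^sub>R f" "T g = b *\<^sub>R g" "a \<noteq> b"
  shows "orthogonal f g"
  using assms by (simp add: orthogonal_def)

lemma finite_self_adjoint_spectrum:
  fixes T :: "'a::euclidean_space \<Rightarrow> 'a"
  assumes adj: "\<And>f g. T f \<bullet> g = f \<bullet> T g"
  shows "finite {\<mu>. \<exists>f. f \<noteq> 0 \<and> T f = \<mu> *\<^sub>R f}" (is "finite ?X")
proof -
  have "\<forall>\<mu>\<in>?X. \<exists>f. f \<noteq> 0 \<and> T f = \<mu> *\<^sub>R f" by blast
  then obtain e where e: "\<And>\<mu>. \<mu> \<in> ?X \<Longrightarrow> e \<mu> \<noteq> 0 \<and> T (e \<mu>) = \<mu> *\<^sub>R e \<mu>"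
    using bchoice[of ?X "\<lambda>\<mu> f. f \<noteq> 0 \<and> T f = \<mu> *\<^sub>R f"] by blast
  have orth: "orthogonal (e a) (e b)" if "a \<in> ?X" "b \<in> ?X" "a \<noteq> b" for a b
    using self_adjoint_eigenvectors_orthogonal[of T "e a" "e b", OF adj] e that by blast
  have inj: "inj_on e ?X"
  proof (rule inj_onI, rule ccontr)
    fix a b assume ab: "a \<in> ?X" "b \<in> ?X" "e a = e b" "a \<noteq> b"
    then have "e a = 0" using orth[of a b] by (simp add: orthogonal_self)
    with e ab show False by blast
  qed
  have "pairwise orthogonal (e ` ?X)"
    using orth unfolding pairwise_def by blast
  moreover have "0 \<notin> e ` ?X"
  proof
    assume "0 \<in> e ` ?X"
    then obtain a where a: "0 = e a" "a \<in> ?X" by (rule imageE)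
    from e[OF a(2)] a(1) show False by simp
  qed
  ultimately have "independent (e ` ?X)"
    by (intro pairwise_orthogonal_independent)
  then have "finite (e ` ?X)" by (rule independent_imp_finite)
  with inj show ?thesis by (simp only: finite_image_iff)
qed

section \<open>Sorted lists of multisets\<close>

lemma nth_sorted_list_of_multiset_le:
  fixes M :: "'a::linorder multiset"
  assumes "j < size (filter_mset (\<lambda>x. x \<le> t) M)"
  shows "sorted_list_of_multiset M ! j \<le> t"
proof (rule ccontr)
  define xs where "xs = sorted_list_of_multiset M"
  assume "\<not> sorted_list_of_multiset M ! j \<le> t"
  then have gt: "t < xs ! j" by (simp add: xs_def)
  have "t < x" if x: "x \<in> set (drop j xs)" for x
  proof -
    obtain i where "i < length (drop j xs)" "x = drop j xs ! i"
      using x unfolding in_set_conv_nth by blast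
    then have i: "i < length xs - j" "x = xs ! (j + i)" by simp_all
    have "xs ! j \<le> xs ! (j + i)"
      using i(1) by (intro sorted_nth_mono) (auto simp: xs_def)
    with gt i(2) show ?thesis by simp
  qed
  then have none: "filter (\<lambda>x. x \<le> t) (drop j xs) = []" by (force simp: filter_empty_conv)
  have "size (filter_mset (\<lambda>x. x \<le> t) M) = length (filter (\<lambda>x. x \<le> t) xs)"
    by (metis mset_filter mset_sorted_list_of_multiset size_mset xs_def)
  also have "\<dots> = length (filter (\<lambda>x. x \<le> t) (take j xs @ drop j xs))" by simp
  also have "\<dots> = length (filter (\<lambda>x. x \<le> t) (take j xs))"
    unfolding filter_append none by simp
  also have "\<dots> \<le> j"
    using length_filter_le[of "\<lambda>x. x \<le> t" "take j xs"] by simp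
  finally show False using assms by simp
qed

lemma size_filter_mset_sum_replicate:
  assumes "finite X"
  shows "size (filter_mset P (\<Sum>x\<in>X. replicate_mset (m x) x)) = (\<Sum>x\<in>{x\<in>X. P x}. m x)"
proof -
  have filter: "filter_mset P (replicate_mset n x) = (if P x then replicate_mset n x else {#})" for n x
    by (induction n) auto
  have "size (filter_mset P (\<Sum>x\<in>X. replicate_mset (m x) x)) = (\<Sum>x\<in>X. if P x then m x else 0)"
    using assms by (induction X) (auto simp: filter)
  also have "\<dots> = (\<Sum>x\<in>{x\<in>X. P x}. m x)"
    using assms by (simp add: sum.inter_filter)
  finally show ?thesis .
qed

section \<open>The Neumann Laplacian\<close>

lemma graph_with_boundaryD:
  assumes "graph_with_boundary G B"
  shows neighbours_sym: "y \<in> neighbours G x \<longleftrightarrow> x \<in> neighbours G y"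
    and neighbours_irrefl: "x \<notin> neighbours G x"
    and boundary_subset: "B \<subseteq> pverts G"
    and neighbours_boundary: "x \<in> B \<Longrightarrow> neighbours G x \<subseteq> interior_verts G B"
    and neighbours_boundary_nonempty: "x \<in> B \<Longrightarrow> neighbours G x \<noteq> {}"
    and neighbours_iff_arc: "y \<in> neighbours G x \<longleftrightarrow> x \<rightarrow>\<^bsub>with_proj G\<^esub> y"
proof -
  interpret pair_graph G using assms by (simp add: graph_with_boundary_def)
  have arc: "y \<in> neighbours G x \<longleftrightarrow> x \<rightarrow>\<^bsub>with_proj G\<^esub> y" for x y
    by (auto simp: neighbours_def dest: in_arcsD2)
  show "y \<in> neighbours G x \<longleftrightarrow> x \<rightarrow>\<^bsub>with_proj G\<^esub> y" by (rule arc)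
  show "y \<in> neighbours G x \<longleftrightarrow> x \<in> neighbours G y"
    unfolding arc using arcs_symmetric[of x y] arcs_symmetric[of y x] by auto
  show "x \<notin> neighbours G x"
    unfolding arc using no_loops' by auto
  show "B \<subseteq> pverts G" using assms by (simp add: graph_with_boundary_def)
  show "neighbours G x \<subseteq> interior_verts G B" if "x \<in> B"
    using assms that by (auto simp: graph_with_boundary_def neighbours_def interior_verts_def)
  show "neighbours G x \<noteq> {}" if "x \<in> B"
  proof -
    have "x \<in> vertex_boundary G (interior_verts G B)"
      using assms that by (simp add: graph_with_boundary_def)
    then show ?thesis unfolding vertex_boundary_def arc[symmetric] by blast
  qed
qed

lemma linear_laplacian: "linear (laplacian G)"
  by (rule linearI)
    (auto simp: laplacian_def vec_eq_iff sum.distrib sum_distrib_left algebra_simps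
        sum_subtractf simp del: sum_constant)

lemma linear_neumann_extension: "linear (neumann_extension G B)"
proof (rule linearI)
  show "neumann_extension G B (f + g) = neumann_extension G B f + neumann_extension G B g" for f g
    by (simp add: neumann_extension_def vec_eq_iff sum.distrib add_divide_distrib)
  show "neumann_extension G B (c *\<^sub>R f) = c *\<^sub>R neumann_extension G B f" for c f
    by (simp add: neumann_extension_def vec_eq_iff sum_distrib_left[symmetric])
qed

lemma linear_neumann_laplacian: "linear (neumann_laplacian G B)"
  by (rule linearI)
    (auto simp: neumann_laplacian_def vec_eq_iff linear_add[OF linear_laplacian]
      linear_add[OF linear_neumann_extension] linear_scale[OF linear_laplacian]
      linear_scale[OF linear_neumann_extension])

text \<open>
  Both sides differ from \<open>\<Sum>x. deg x * F x * H x\<close> by a sum over ordered pairs of adjacent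
  vertices, and exchanging the two vertices turns one of these sums into the other.
\<close>

lemma inner_laplacian_commute:
  assumes "graph_with_boundary G B"
  shows "laplacian G F \<bullet> H = F \<bullet> laplacian G H"
proof -
  have expand: "laplacian G F \<bullet> H = (\<Sum>x\<in>UNIV. real (deg G x) * F $ x * H $ x)
      - (\<Sum>x\<in>UNIV. \<Sum>y\<in>UNIV. if y \<in> neighbours G x then F $ y * H $ x else 0)" for F H
    by (simp add: inner_vec_def laplacian_def sum_subtractf left_diff_distrib sum_distrib_right
        deg_def flip: sum.inter_restrict)
  have "(\<Sum>x\<in>UNIV. \<Sum>y\<in>UNIV. if y \<in> neighbours G x then F $ y * H $ x else 0)
      = (\<Sum>x\<in>UNIV. \<Sum>y\<in>UNIV. if y \<in> neighbours G x then H $ y * F $ x else 0)"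
    using neighbours_sym[OF assms]
    by (subst sum.swap) (auto intro!: sum.cong simp: mult.commute)
  then show ?thesis
    unfolding inner_commute[of F] expand by (simp add: mult.commute mult.left_commute)
qed

text \<open>
  The averaging rule of the Neumann extension is chosen to make the extension harmonic at the
  boundary: the neighbours of a boundary vertex are interior, where the extension agrees with
  the given function.
\<close>

lemma laplacian_neumann_extension_boundary:
  assumes gb: "graph_with_boundary G B" and x: "x \<in> B"
  shows "laplacian G (neumann_extension G B f) $ x = 0"
proof -
  have "(\<Sum>y\<in>neighbours G x. neumann_extension G B f $ y) = (\<Sum>y\<in>neighbours G x. f $ y)"
    using neighbours_boundary[OF gb x] by (intro sum.cong) (auto simp: neumann_extension_def)
  moreover have "deg G x > 0"
    using neighbours_boundary_nonempty[OF gb x] by (simp add: deg_def card_gt_0_iff)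
  ultimately show ?thesis
    using x by (simp add: laplacian_def sum_subtractf neumann_extension_def interior_verts_def deg_def)
qed

text \<open>
  On the left only interior vertices contribute.  There \<open>g\<close> agrees with its extension, and on the
  right the boundary vertices contribute \<open>0\<close>, so the symmetry of the Laplacian of the whole graph
  becomes available for the Neumann Laplacian.
\<close>

lemma inner_neumann_laplacian:
  assumes gb: "graph_with_boundary G B"
  shows "neumann_laplacian G B f \<bullet> g =
    laplacian G (neumann_extension G B f) \<bullet> neumann_extension G B g"
  unfolding inner_vec_def
proof (rule sum.cong[OF refl])
  fix x
  show "neumann_laplacian G B f $ x \<bullet> g $ x =
    laplacian G (neumann_extension G B f) $ x \<bullet> neumann_extension G B g $ x"
    using laplacian_neumann_extension_boundary[OF gb, of x f]
    by (simp add: neumann_laplacian_def)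
       (auto simp: neumann_extension_def)
qed

lemma inner_neumann_laplacian_commute:
  assumes "graph_with_boundary G B"
  shows "neumann_laplacian G B f \<bullet> g = f \<bullet> neumann_laplacian G B g"
  unfolding inner_commute[of f] inner_neumann_laplacian[OF assms]
  by (subst inner_laplacian_commute[OF assms]) (rule inner_commute)

lemma neumann_laplacian_indicator:
  assumes gb: "graph_with_boundary G B"
  shows "neumann_laplacian G B (\<chi> x. indicator (interior_verts G B) x) = 0"
proof -
  have ext: "neumann_extension G B (\<chi> x. indicator (interior_verts G B) x) $ x = 1"
    if "x \<in> pverts G" for x
  proof (cases "x \<in> B")
    case True
    have "(\<Sum>y\<in>neighbours G x. indicator (interior_verts G B) y) = (\<Sum>y\<in>neighbours G x. 1::real)"
      using neighbours_boundary[OF gb True] by (intro sum.cong) auto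
    then show ?thesis
      using True neighbours_boundary_nonempty[OF gb True]
      by (simp add: neumann_extension_def interior_verts_def deg_def)
  next
    case False
    then show ?thesis using that by (simp add: neumann_extension_def interior_verts_def)
  qed
  show ?thesis
    by (auto simp: neumann_laplacian_def laplacian_def vec_eq_iff interior_verts_def
        neighbours_def ext[unfolded interior_verts_def] intro!: sum.neutral)
qed

section \<open>Bounding the second eigenvalue\<close>

lemma card_le_dim_neumann_eigenspace:
  assumes "X \<subseteq> neumann_eigenspace G B \<mu>" "pairwise orthogonal X" "0 \<notin> X"
  shows "card X \<le> dim (neumann_eigenspace G B \<mu>)"
  using assms by (intro independent_card_le_dim pairwise_orthogonal_independent) auto

text \<open>
  The indicator \<open>u\<close> of the interior and a minimiser \<open>h\<close> of the Rayleigh quotient on the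
  orthogonal complement of \<open>u\<close> are orthogonal eigenvectors.  If their eigenvalues coincide, the
  common eigenspace has dimension at least two, so the eigenvalue occurs twice in the list.
\<close>

lemma neumann_eigenvalue_2_le_Rayleigh:
  fixes G :: "'v::finite pair_pre_digraph"
  assumes gb: "graph_with_boundary G B"
    and g: "g \<in> functions_on (interior_verts G B)" "g \<noteq> 0" "(\<Sum>x\<in>interior_verts G B. g $ x) = 0"
    and t: "0 \<le> t" "g \<bullet> neumann_laplacian G B g \<le> t * (g \<bullet> g)"
  shows "neumann_eigenvalue G B 2 \<le> t"
proof -
  define \<Omega> where "\<Omega> = interior_verts G B"
  define N where "N = neumann_laplacian G B"
  define E where "E = neumann_eigenspace G B"
  define u :: "real ^ 'v" where "u = (\<chi> x. indicator \<Omega> x)"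
  define S where "S = functions_on \<Omega> \<inter> {f. u \<bullet> f = 0}"
  have adj: "N f \<bullet> f' = f \<bullet> N f'" for f f'
    unfolding N_def by (rule inner_neumann_laplacian_commute[OF gb])
  have Nu: "N u = 0"
    using neumann_laplacian_indicator[OF gb] by (simp add: N_def u_def \<Omega>_def)
  have "subspace S"
    unfolding S_def
    by (auto simp: subspace_def functions_on_def inner_right_distrib)
  moreover have "N f \<in> S" for f
    using adj[of u f] Nu by (auto simp: S_def functions_on_def N_def neumann_laplacian_def \<Omega>_def)
  moreover have gS: "g \<in> S"
    using g(1,3)
    by (simp add: S_def u_def \<Omega>_def inner_vec_def indicator_def if_distrib sum.If_cases cong: if_cong)
  moreover have "linear N" unfolding N_def by (rule linear_neumann_laplacian)
  ultimately obtain h \<mu> where h: "h \<in> S" "h \<noteq> 0" "N h = \<mu> *\<^sub>R h"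
    and min: "\<And>f. f \<in> S \<Longrightarrow> \<mu> * (f \<bullet> f) \<le> f \<bullet> N f"
    using self_adjoint_min_eigenvector[of N S g] adj g(2) by blast
  have \<mu>t: "\<mu> \<le> t"
  proof -
    have "\<mu> * (g \<bullet> g) \<le> t * (g \<bullet> g)"
      using min[OF gS] t(2) by (simp add: N_def)
    then show ?thesis using g(2) by simp
  qed
  have u0: "u \<noteq> 0"
  proof
    assume "u = 0"
    then have "\<Omega> = {}" by (auto simp: u_def vec_eq_iff indicator_def split: if_splits)
    then show False using g(1,2) by (simp add: functions_on_def vec_eq_iff \<Omega>_def)
  qed
  have uE: "u \<in> E 0"
    using Nu by (simp add: E_def neumann_eigenspace_def N_def functions_on_def u_def \<Omega>_def)
  have hE: "h \<in> E \<mu>"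
    using h by (simp add: E_def neumann_eigenspace_def N_def S_def \<Omega>_def)
  have uh: "orthogonal u h" using h(1) by (simp add: S_def orthogonal_def)
  let ?X = "neumann_spectrum G B"
  have fin: "finite ?X"
    using finite_self_adjoint_spectrum[of N, OF adj]
    by (rule rev_finite_subset) (auto simp: neumann_spectrum_def neumann_eigenspace_def N_def)
  have X: "0 \<in> ?X" "\<mu> \<in> ?X"
    using uE hE u0 h(2) by (auto simp: neumann_spectrum_def E_def)
  have "2 \<le> (\<Sum>x\<in>{0, \<mu>}. dim (E x))"
  proof (cases "\<mu> = 0")
    case True
    have "u \<noteq> h" using uh u0 by (auto simp: orthogonal_self)
    then have "card {u, h} = 2" by simp
    moreover have "card {u, h} \<le> dim (E 0)"
      unfolding E_def using uE hE u0 h(2) uh True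
      by (intro card_le_dim_neumann_eigenspace)
         (auto simp: E_def pairwise_def orthogonal_commute)
    ultimately show ?thesis using True by simp
  next
    case False
    have "card {u} \<le> dim (E 0)" "card {h} \<le> dim (E \<mu>)"
      unfolding E_def using uE hE u0 h(2)
      by (intro card_le_dim_neumann_eigenspace; auto simp: E_def)+
    then show ?thesis using False by simp
  qed
  also have "\<dots> \<le> (\<Sum>x\<in>{x \<in> ?X. x \<le> t}. dim (E x))"
    using fin X \<mu>t t(1) by (intro sum_mono2) auto
  also have "\<dots> = size (filter_mset (\<lambda>x. x \<le> t) (\<Sum>x\<in>?X. replicate_mset (dim (E x)) x))"
    by (rule size_filter_mset_sum_replicate[OF fin, symmetric])
  finally show ?thesis
    unfolding neumann_eigenvalue_def neumann_eigenvalues_def E_def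
    by (intro nth_sorted_list_of_multiset_le) simp
qed

text \<open>
  At a boundary vertex \<open>z\<close> the extension averages \<open>1\<^sub>a - 1\<^sub>b\<close> over the neighbours of \<open>z\<close>; as \<open>b\<close>
  is one of them, its contribution \<open>-1 / deg z\<close> cancels whatever \<open>a\<close> may contribute.  At an
  interior vertex the extension is \<open>1\<^sub>a - 1\<^sub>b\<close> itself, which is positive at \<open>a\<close> only.
\<close>

lemma neumann_extension_diff_axis_le:
  fixes G :: "'v::finite pair_pre_digraph"
  assumes gb: "graph_with_boundary G B" and z: "z \<in> neighbours G b"
  shows "neumann_extension G B (axis a 1 - axis b 1) $ z \<le> (if z = a then 1 else 0)"
proof -
  consider "z \<in> interior_verts G B" | "z \<in> B"
    using z by (auto simp: neighbours_def interior_verts_def)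
  then show ?thesis
  proof cases
    case 1
    then show ?thesis by (auto simp: neumann_extension_def axis_def)
  next
    case 2
    have zb: "b \<in> neighbours G z" using z neighbours_sym[OF gb] by blast
    have "(\<Sum>y\<in>neighbours G z. (axis a 1 - axis b 1 :: real ^ 'v) $ y)
        = (\<Sum>y\<in>neighbours G z. if y = a then 1 else 0) - (\<Sum>y\<in>neighbours G z. if y = b then 1 else 0)"
      by (simp add: sum_subtractf axis_def)
    also have "\<dots> \<le> 0" using zb by simp
    finally have "neumann_extension G B (axis a 1 - axis b 1) $ z \<le> 0"
      using 2 by (simp add: neumann_extension_def interior_verts_def divide_nonpos_nonneg)
    then show ?thesis by (auto intro: order_trans)
  qed
qed

lemma inner_neumann_laplacian_diff_axis_le:
  fixes G :: "'v::finite pair_pre_digraph"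
  assumes gb: "graph_with_boundary G B" and ab: "a \<in> interior_verts G B" "b \<in> interior_verts G B"
    "a \<noteq> b"
  defines "g \<equiv> axis a 1 - axis b 1 :: real ^ 'v"
  shows "g \<bullet> neumann_laplacian G B g
    \<le> real (deg G a) + real (deg G b) + (if a \<rightarrow>\<^bsub>with_proj G\<^esub> b then 2 else 0)"
proof -
  define F where "F = neumann_extension G B g"
  have F: "F $ a = 1" "F $ b = -1"
    using ab by (simp_all add: F_def g_def neumann_extension_def axis_def)
  have lap: "laplacian G F $ x = real (deg G x) * F $ x - (\<Sum>z\<in>neighbours G x. F $ z)" for x
    by (simp add: laplacian_def sum_subtractf deg_def)
  have "g \<bullet> neumann_laplacian G B g = laplacian G F $ a - laplacian G F $ b"
    using ab by (simp add: g_def inner_diff_left inner_axis' neumann_laplacian_def F_def)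
  also have "\<dots> = real (deg G a) + real (deg G b)
      + (\<Sum>z\<in>neighbours G a. - F $ z) + (\<Sum>z\<in>neighbours G b. F $ z)"
    unfolding lap F by (simp add: sum_negf)
  also have "\<dots> \<le> real (deg G a) + real (deg G b)
      + (\<Sum>z\<in>neighbours G a. if z = b then 1 else 0)
      + (\<Sum>z\<in>neighbours G b. if z = a then 1 else 0)"
  proof (intro add_mono sum_mono order_refl)
    fix z assume "z \<in> neighbours G b"
    then show "F $ z \<le> (if z = a then 1 else 0)"
      unfolding F_def g_def by (rule neumann_extension_diff_axis_le[OF gb])
  next
    fix z assume z: "z \<in> neighbours G a"
    \<comment> \<open>Exchanging \<open>a\<close> and \<open>b\<close> negates the extension, so the bound at \<open>b\<close> applies at \<open>a\<close> too.\<close>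
    have "- F = neumann_extension G B (axis b 1 - axis a 1)"
      unfolding F_def g_def linear_neg[OF linear_neumann_extension, symmetric] by simp
    then have "- F $ z = neumann_extension G B (axis b 1 - axis a 1) $ z"
      by (metis vector_uminus_component)
    then show "- F $ z \<le> (if z = b then 1 else 0)"
      using neumann_extension_diff_axis_le[OF gb z] by simp
  qed
  also have "\<dots> = real (deg G a) + real (deg G b) + (if a \<rightarrow>\<^bsub>with_proj G\<^esub> b then 2 else 0)"
    using neighbours_sym[OF gb, of a b] neighbours_iff_arc[OF gb, of b a] by simp
  finally show ?thesis .
qed

theorem theorem1p2:
  fixes G :: "'v::finite pair_pre_digraph" and B :: "'v set"
    and v :: "nat \<Rightarrow> 'v" and k d\<^sub>1 d\<^sub>2 :: nat
  assumes "graph_with_boundary G B"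
    and "Digraph_Component.connected (with_proj G)"
    and "k \<ge> 2"
    and "bij_betw v {1..k} (interior_verts G B)"
    and "deg G (v 1) = Min ((\<lambda>i. deg G (v i)) ` {1..k})"
    and "deg G (v 2) = Min ((\<lambda>i. deg G (v i)) ` {2..k})"
    and "d\<^sub>1 = deg G (v 1)" and "d\<^sub>2 = deg G (v 2)"
  shows "neumann_eigenvalue G B 2 \<le>
    (if v 1 \<rightarrow>\<^bsub>with_proj G\<^esub> v 2 then (real d\<^sub>1 + real d\<^sub>2) / 2 + 1
     else (real d\<^sub>1 + real d\<^sub>2) / 2)"
proof -
  note gb = assms(1)
  let ?g = "axis (v 1) 1 - axis (v 2) 1 :: real ^ 'v"
  have in\<Omega>: "v 1 \<in> interior_verts G B" "v 2 \<in> interior_verts G B"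
    using assms(3,4) by (auto simp: bij_betw_def)
  have ne: "v 1 \<noteq> v 2"
    using assms(3,4) inj_onD[of v "{1..k}" 1 2] by (auto simp: bij_betw_def)
  have norm: "?g \<bullet> ?g = 2"
    using ne by (simp add: inner_diff_left inner_diff_right inner_axis_axis)
  show ?thesis
  proof (rule neumann_eigenvalue_2_le_Rayleigh[OF gb, of ?g])
    show "?g \<in> functions_on (interior_verts G B)"
      using in\<Omega> by (auto simp: functions_on_def axis_def)
    show "?g \<noteq> 0" using norm by force
    show "(\<Sum>x\<in>interior_verts G B. ?g $ x) = 0"
      using in\<Omega> by (simp add: sum_subtractf axis_def)
    show "?g \<bullet> neumann_laplacian G B ?g \<le> (if v 1 \<rightarrow>\<^bsub>with_proj G\<^esub> v 2
        then (real d\<^sub>1 + real d\<^sub>2) / 2 + 1 else (real d\<^sub>1 + real d\<^sub>2) / 2) * (?g \<bullet> ?g)"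
      using inner_neumann_laplacian_diff_axis_le[OF gb in\<Omega> ne] unfolding norm assms(7,8)
      by (auto split: if_splits simp: field_simps)
  qed simp
qed

end
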